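(* Consider the linear program $\min_{x\in\mathbb{R}^n}\{\langle c,x\rangle\mid Bx\ge d\}$, where $c\in\mathbb{R}^n$, $B$ is a $p\times n$ full rank real matrix with $p\ge n$ and rows $B_1,\dots,B_p$, and $d\in\mathbb{R}^p$. Assume that it admits a unique solution $a$, and let $x^0\in\mathbb{R}^n$ satisfy $Bx^0>d$. Let $$h(x)=\sum_{i=1}^p\theta(\langle B_i,x\rangle-d_i),$$ where $\theta\in\Gamma_0(\mathbb{R})$ is a function of Legendre type satisfying: $(0,\infty)\subset\operatorname{dom}\theta\subset[0,\infty)$; $\theta\in\mathcal{C}^3(0,\infty)$ and $\lim_{s\to0^+}\theta'(s)=-\infty$; $\theta''(s)>0$ for all $s>0$. Assume in addition that $\theta$ is a Bregman function with zone $(0,\infty)$ and that there exist $\alpha>0$, $\beta\ge1$ and $\varepsilon>0$ such that $$\alpha D_\theta(0,s)^\beta\le s\quad\text{for all }s\in(0,\varepsilon).$$ Then there exist positive constants $K,L,M$ such that for all $t>0$ the trajectory $x(t)$ of $(H\text{-}SD)$ starting at $x(0)=x^0$ satisfies $$D_h(a,x(t))\le Ke^{-Lt}\ \text{ if }\beta=1,\qquad D_h(a,x(t))\le M/t^{\frac1{\beta-1}}\ \text{ if }\beta>1.$$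
   Context: $\Gamma_0(\mathbb{R}^n)$ is the set of lower semicontinuous proper convex functions $\mathbb{R}^n\to\mathbb{R}\cup\{+\infty\}$. A function $g\in\Gamma_0(\mathbb{R}^n)$ is of Legendre type if it is differentiable on $\operatorname{int}\operatorname{dom}g$, $|\nabla g(x^j)|\to+\infty$ for every sequence $(x^j)\subset\operatorname{int}\operatorname{dom}g$ converging to a boundary point of $\operatorname{dom}g$, and $g$ is strictly convex on $\operatorname{int}\operatorname{dom}g$. For such $g$, $D_g(x,y)=g(x)-g(y)-\langle\nabla g(y),x-y\rangle$ for $x\in\operatorname{dom}g$, $y\in\operatorname{int}\operatorname{dom}g$. For an open convex set $C$, $g\in\Gamma_0(\mathbb{R}^n)$ is a Bregman function with zone $C$ if: (i) $\operatorname{dom}g=\overline{C}$, $g$ is continuous and strictly convex on $\overline{C}$ and $g_{|C}\in\mathcal{C}^1(C;\mathbb{R})$; (ii) for all $a\in\overline{C}$ and $\gamma\in\mathbb{R}$, $\{y\in C\mid D_g(a,y)\le\gamma\}$ is bounded; (iii) for all $y\in\overline{C}$ and all sequences $y^j\to y$ with $y^j\in C$, $D_g(y,y^j)\to0$. Here $C=\{x\in\mathbb{R}^n\mid Bx>d\}$, $H=\nabla^2h$ on $C$ (positive definite there), there are no equality constraints, and $(H\text{-}SD)$ is the Cauchy problem in $C$: $\dot x(t)+H(x(t))^{-1}c=0$, $x(0)=x^0\in C$ (whose solution exists for all $t\ge0$). *)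

theory Defs
  imports "HOL-Analysis.Analysis"
begin

definition eff_dom :: "('a \<Rightarrow> ereal) \<Rightarrow> 'a set" where
  "eff_dom g = {x. g x < \<infinity>}"

text \<open>
  The real-valued version of an extended-valued function.  It is only meaningful on the effective
  domain; outside it has the value 0.  Derivatives of \<open>g\<close> are derivatives of \<open>fin g\<close>, and they are
  only considered at interior points of the effective domain.
\<close>

definition fin :: "('a \<Rightarrow> ereal) \<Rightarrow> 'a \<Rightarrow> real" where
  "fin g x = real_of_ereal (g x)"

definition proper_fun :: "('a \<Rightarrow> ereal) \<Rightarrow> bool" where
  "proper_fun g \<longleftrightarrow> (\<forall>x. g x \<noteq> -\<infinity>) \<and> (\<exists>x. g x \<noteq> \<infinity>)"

definition lower_semicont :: "('a::topological_space \<Rightarrow> ereal) \<Rightarrow> bool" where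
  "lower_semicont g \<longleftrightarrow> (\<forall>x. g x \<le> Liminf (at x) g)"

text \<open>
  The weights are strictly between 0 and 1, so that no product of 0 and infinity occurs.
\<close>

definition convex_ereal :: "('a::real_vector \<Rightarrow> ereal) \<Rightarrow> bool" where
  "convex_ereal g \<longleftrightarrow> (\<forall>x y. \<forall>u::real. 0 < u \<and> u < 1 \<longrightarrow>
     g ((1 - u) *\<^sub>R x + u *\<^sub>R y) \<le> ereal (1 - u) * g x + ereal u * g y)"

definition strictly_convex_on :: "'a::real_vector set \<Rightarrow> ('a \<Rightarrow> ereal) \<Rightarrow> bool" where
  "strictly_convex_on S g \<longleftrightarrow> convex S \<and>
     (\<forall>x\<in>S. \<forall>y\<in>S. \<forall>u::real. x \<noteq> y \<and> 0 < u \<and> u < 1 \<longrightarrow>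
        g ((1 - u) *\<^sub>R x + u *\<^sub>R y) < ereal (1 - u) * g x + ereal u * g y)"

definition Gamma0 :: "('a::euclidean_space \<Rightarrow> ereal) set" where
  "Gamma0 = {g. proper_fun g \<and> lower_semicont g \<and> convex_ereal g}"

definition gradient :: "('a::real_inner \<Rightarrow> real) \<Rightarrow> 'a \<Rightarrow> 'a" where
  "gradient f x = (THE D. GDERIV f x :> D)"

definition hessian :: "(real^'n \<Rightarrow> real) \<Rightarrow> real^'n \<Rightarrow> real^'n^'n" where
  "hessian f x = matrix (frechet_derivative (gradient f) (at x))"

text \<open>\<open>breg g x y\<close> is meant for \<open>x\<close> in the effective domain of \<open>g\<close> and \<open>y\<close> in its interior.\<close>

definition breg :: "('a::euclidean_space \<Rightarrow> ereal) \<Rightarrow> 'a \<Rightarrow> 'a \<Rightarrow> real" where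
  "breg g x y = fin g x - fin g y - gradient (fin g) y \<bullet> (x - y)"

definition legendre_type :: "('a::euclidean_space \<Rightarrow> ereal) \<Rightarrow> bool" where
  "legendre_type g \<longleftrightarrow>
     g \<in> Gamma0 \<and>
     (\<forall>x\<in>interior (eff_dom g). fin g differentiable (at x)) \<and>
     (\<forall>xs z. (\<forall>j::nat. xs j \<in> interior (eff_dom g)) \<and> z \<in> frontier (eff_dom g) \<and> xs \<longlonglongrightarrow> z
        \<longrightarrow> filterlim (\<lambda>j. norm (gradient (fin g) (xs j))) at_top sequentially) \<and>
     strictly_convex_on (interior (eff_dom g)) g"

definition bregman_function :: "'a::euclidean_space set \<Rightarrow> ('a \<Rightarrow> ereal) \<Rightarrow> bool" where
  "bregman_function C g \<longleftrightarrow>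
     open C \<and> convex C \<and> g \<in> Gamma0 \<and>
     eff_dom g = closure C \<and>
     continuous_on (closure C) g \<and>
     strictly_convex_on (closure C) g \<and>
     (\<forall>x\<in>C. fin g differentiable (at x)) \<and> continuous_on C (gradient (fin g)) \<and>
     (\<forall>a\<in>closure C. \<forall>\<gamma>::real. bounded {y\<in>C. breg g a y \<le> \<gamma>}) \<and>
     (\<forall>y\<in>closure C. \<forall>ys. (\<forall>j::nat. ys j \<in> C) \<and> ys \<longlonglongrightarrow> y
        \<longrightarrow> (\<lambda>j. breg g y (ys j)) \<longlonglongrightarrow> 0)"

text \<open>Meant for open \<open>S\<close>, where differentiability within \<open>S\<close> is ordinary differentiability.\<close>

definition Ck_on :: "nat \<Rightarrow> real set \<Rightarrow> (real \<Rightarrow> real) \<Rightarrow> bool" where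
  "Ck_on k S f \<longleftrightarrow>
     (\<forall>j<k. (deriv ^^ j) f differentiable_on S) \<and> continuous_on S ((deriv ^^ k) f)"

text \<open>
  The strict inequality is spelled out in components: the strict order on vectors in the library
  only requires \<open>\<le>\<close> in every component and \<open><\<close> in at least one.
\<close>

definition strict_feasible :: "real^'n^'p \<Rightarrow> real^'p \<Rightarrow> (real^'n) set" where
  "strict_feasible B d = {x. \<forall>i. (B *v x) $ i > d $ i}"

definition lp_solutions :: "real^'n \<Rightarrow> real^'n^'p \<Rightarrow> real^'p \<Rightarrow> (real^'n) set" where
  "lp_solutions c B d =
     {a. is_arg_min (\<lambda>x. c \<bullet> x) (\<lambda>x. \<forall>i. (B *v x) $ i \<ge> d $ i) a}"

text \<open>
  Global solutions in \<open>C\<close> of the Cauchy problem \<open>x' + H(x)\<^sup>-\<^sup>1 c = 0\<close>, \<open>x(0) = x0\<close>, where \<open>H\<close> is the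
  Hessian of \<open>h\<close>.  The derivative at \<open>t = 0\<close> is one-sided.
\<close>

definition HSD_solution ::
  "(real^'n \<Rightarrow> ereal) \<Rightarrow> (real^'n) set \<Rightarrow> real^'n \<Rightarrow> real^'n \<Rightarrow> (real \<Rightarrow> real^'n) \<Rightarrow> bool" where
  "HSD_solution h C c x0 x \<longleftrightarrow>
     x 0 = x0 \<and>
     (\<forall>t\<ge>0. x t \<in> C \<and>
        (x has_vector_derivative - (matrix_inv (hessian (fin h) (x t)) *v c)) (at t within {0..}))"

end

theory Submission
  imports Defs
begin

text \<open>
  Put \<open>\<phi> t = D\<^sub>h(a, x(t))\<close>.  Since \<open>H(x) x' = - c\<close>, one gets \<open>\<phi>' = - \<langle>c, x - a\<rangle>\<close>, so the theorem
  reduces to the error bound \<open>\<kappa> \<phi>\<^sup>\<beta> \<le> \<langle>c, x - a\<rangle>\<close>, which turns into the differential inequality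
  \<open>\<phi>' \<le> - \<kappa> \<phi>\<^sup>\<beta>\<close>.  A unique solution of a linear program is a sharp minimum,
  \<open>\<langle>c, y - a\<rangle> \<ge> \<mu> |y - a|\<close> on the feasible set.  Near \<open>a\<close> the \<open>\<beta>\<close>-th power of each summand of \<open>D\<^sub>h\<close>
  is bounded by a multiple of \<open>|y - a|\<close>: by the hypothesis on \<open>\<theta>\<close> for active constraints, by the
  continuity of \<open>\<theta>'\<close> for inactive ones.  Away from \<open>a\<close> the bound \<open>\<phi> t \<le> \<phi> 0\<close> is enough, so neither
  boundedness nor convergence of the trajectory has to be established.
\<close>

section \<open>Gradients on inner product spaces\<close>

lemma gradient_eqI:
  assumes "(f has_derivative (\<lambda>v. g \<bullet> v)) (at x)"
  shows "gradient f x = g"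
  unfolding gradient_def
proof (rule the_equality)
  show "GDERIV f x :> g"
    using assms by (simp add: gderiv_def inner_commute)
next
  fix D
  assume "GDERIV f x :> D"
  then have "(\<lambda>v. v \<bullet> D) = (\<lambda>v. g \<bullet> v)"
    using assms unfolding gderiv_def by (rule has_derivative_unique)
  then have "v \<bullet> D = v \<bullet> g" for v
    by (metis inner_commute)
  then have "(D - g) \<bullet> (D - g) = 0"
    by (simp add: inner_diff_right)
  then show "D = g"
    by simp
qed

lemma gradient_real:
  fixes f :: "real \<Rightarrow> real"
  assumes "(f has_real_derivative D) (at x)"
  shows "gradient f x = D"
  by (rule gradient_eqI) (use assms in \<open>simp add: has_field_derivative_def\<close>)

section \<open>Linear programming: sharpness of a unique minimizer\<close>

lemma sharp_minimum:
  fixes c a :: "real^'n" and B :: "real^'n^'p"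
  assumes "lp_solutions c B d = {a}"
  obtains \<mu> where "\<mu> > 0"
    and "\<And>y. \<forall>i. (B *v y) $ i \<ge> d $ i \<Longrightarrow> c \<bullet> y - c \<bullet> a \<ge> \<mu> * norm (y - a)"
proof -
  have opt: "is_arg_min (\<lambda>x. c \<bullet> x) (\<lambda>x. \<forall>i. (B *v x) $ i \<ge> d $ i) a"
    using assms unfolding lp_solutions_def by blast
  have feas: "\<And>i. (B *v a) $ i \<ge> d $ i"
    and le: "\<And>y. \<forall>i. (B *v y) $ i \<ge> d $ i \<Longrightarrow> c \<bullet> a \<le> c \<bullet> y"
    using opt by (auto simp: is_arg_min_linorder)
  have strict: "c \<bullet> a < c \<bullet> y" if "\<forall>i. (B *v y) $ i \<ge> d $ i" "y \<noteq> a" for y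
  proof (rule ccontr)
    assume "\<not> c \<bullet> a < c \<bullet> y"
    then have "y \<in> lp_solutions c B d"
      using that le unfolding lp_solutions_def is_arg_min_linorder by fastforce
    then show False using assms that by simp
  qed
  \<comment> \<open>The cone of feasible directions at \<open>a\<close>: it contains \<open>y - a\<close> for every feasible \<open>y\<close>, and \<open>c\<close>
    attains a positive minimum on its compact intersection with the unit sphere.\<close>
  define T where "T = {v. \<forall>i. (B *v a) $ i = d $ i \<longrightarrow> (B *v v) $ i \<ge> 0}"
  \<comment> \<open>A short step from \<open>a\<close> along \<open>v\<close> stays feasible: active
    constraints do not decrease along \<open>v\<close>, inactive ones have slack to spare, and
    finitely many constraints admit a common step length. Uniqueness of the minimizer then makes the
    objective grow strictly.\<close>
  have T: "0 < c \<bullet> v" if "v \<in> T" "v \<noteq> 0" for v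
  proof -
    have "\<forall>\<^sub>F t in at_right 0. (B *v (a + t *\<^sub>R v)) $ i \<ge> d $ i" for i
    proof (cases "(B *v a) $ i = d $ i")
      case True
      then have "(B *v v) $ i \<ge> 0" using that by (simp add: T_def)
      then show ?thesis
        using True by (auto simp: eventually_at_filter matrix_vector_right_distrib matrix_vector_mult_scaleR)
    next
      case False
      then have "(B *v a) $ i > d $ i" using feas[of i] by linarith
      moreover have "((\<lambda>t. (B *v a) $ i + t * (B *v v) $ i) \<longlongrightarrow> (B *v a) $ i + 0 * (B *v v) $ i) (at_right 0)"
        by (intro tendsto_intros)
      ultimately have "\<forall>\<^sub>F t in at_right 0. (B *v a) $ i + t * (B *v v) $ i > d $ i"
        by (intro order_tendstoD) auto
      then show ?thesis
        by eventually_elim (simp add: matrix_vector_right_distrib matrix_vector_mult_scaleR)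
    qed
    then have "\<forall>\<^sub>F t in at_right 0. \<forall>i. (B *v (a + t *\<^sub>R v)) $ i \<ge> d $ i"
      by (simp add: eventually_all_finite)
    moreover have "\<forall>\<^sub>F t in at_right (0::real). t > 0"
      by (simp add: eventually_at_right_less)
    ultimately have "\<forall>\<^sub>F t in at_right 0. t > 0 \<and> (\<forall>i. (B *v (a + t *\<^sub>R v)) $ i \<ge> d $ i)"
      by eventually_elim simp
    then obtain t :: real where t: "t > 0" "\<forall>i. (B *v (a + t *\<^sub>R v)) $ i \<ge> d $ i"
      using eventually_happens'[OF trivial_limit_at_right_real] by blast
    then have "c \<bullet> a < c \<bullet> (a + t *\<^sub>R v)"
      using strict that by simp
    then show ?thesis
      using t by (simp add: inner_add_right zero_less_mult_iff)
  qed
  have "closed T"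
    unfolding T_def
    by (intro closed_Collect_all closed_Collect_imp open_Collect_const closed_Collect_le
        continuous_on_const continuous_on_component matrix_vector_mult_linear_continuous_on)
  then have "compact (T \<inter> sphere 0 1)"
    by (simp add: closed_Int_compact)
  obtain \<mu> where \<mu>: "\<mu> > 0" "\<And>v. v \<in> T \<inter> sphere 0 1 \<Longrightarrow> \<mu> \<le> c \<bullet> v"
  proof (cases "T \<inter> sphere 0 1 = {}")
    \<comment> \<open>Here \<open>T\<close> contains only 0, so \<open>a\<close> is the only
      feasible point and any positive constant works.\<close>
    case True
    then show ?thesis using that[of 1] by auto
  next
    case False
    have "continuous_on (T \<inter> sphere 0 1) (\<lambda>v. c \<bullet> v)"
      by (intro continuous_intros)
    then obtain w where "w \<in> T \<inter> sphere 0 1" "\<And>v. v \<in> T \<inter> sphere 0 1 \<Longrightarrow> c \<bullet> w \<le> c \<bullet> v"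
      using continuous_attains_inf[OF \<open>compact _\<close> False] by blast
    moreover from this have "w \<noteq> 0" by auto
    ultimately show ?thesis using that[of "c \<bullet> w"] T[of w] by blast
  qed
  show ?thesis
  proof (rule that[OF \<mu>(1)])
    fix y
    assume y: "\<forall>i. (B *v y) $ i \<ge> d $ i"
    show "c \<bullet> y - c \<bullet> a \<ge> \<mu> * norm (y - a)"
    proof (cases "y = a")
      case False
      define v where "v = (1 / norm (y - a)) *\<^sub>R (y - a)"
      have "(B *v (y - a)) $ i \<ge> 0" if "(B *v a) $ i = d $ i" for i
        using y that by (simp add: matrix_vector_mult_diff_distrib)
      then have "v \<in> T \<inter> sphere 0 1"
        using False by (simp add: v_def T_def matrix_vector_mult_scaleR)
      from \<mu>(2)[OF this] show ?thesis
        using False by (simp add: v_def field_simps inner_diff_right)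
    qed simp
  qed
qed

section \<open>Scalar differential inequalities\<close>

text \<open>The derivative at time 0 is only one-sided. The mean value argument uses two-sided
  derivatives strictly inside the interval and mere continuity at its ends.\<close>

lemma nonincreasing_within:
  fixes \<phi> \<phi>' :: "real \<Rightarrow> real"
  assumes der: "\<And>t. t \<ge> 0 \<Longrightarrow> (\<phi> has_real_derivative \<phi>' t) (at t within {0..})"
    and le: "\<And>t. t \<ge> 0 \<Longrightarrow> \<phi>' t \<le> 0"
    and "0 \<le> s" "s \<le> t"
  shows "\<phi> t \<le> \<phi> s"
proof (rule DERIV_nonpos_imp_decreasing_open[of s t \<phi>])
  fix r assume "s < r" "r < t"
  then show "\<exists>y. (\<phi> has_real_derivative y) (at r) \<and> y \<le> 0"
    using der[of r] le[of r] \<open>0 \<le> s\<close> at_within_interior[of r "{0..}"] by auto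
next
  have "continuous_on {0..} \<phi>"
    by (auto intro!: DERIV_continuous_on der)
  then show "continuous_on {s..t} \<phi>"
    by (rule continuous_on_subset) (use \<open>0 \<le> s\<close> in auto)
qed fact

text \<open>Separation of variables: for \<beta> = 1 the integrating factor
  \<open>exp (\<kappa> * s)\<close> is used, for \<beta> > 1 the substitution
  \<open>\<phi> s powr (1 - \<beta>)\<close>, which grows at rate at least
  \<open>(\<beta> - 1) * \<kappa>\<close>.\<close>

lemma powr_decay:
  fixes \<phi> \<phi>' :: "real \<Rightarrow> real"
  assumes der: "\<And>t. t \<ge> 0 \<Longrightarrow> (\<phi> has_real_derivative \<phi>' t) (at t within {0..})"
    and nonneg: "\<And>t. t \<ge> 0 \<Longrightarrow> \<phi> t \<ge> 0"
    and le: "\<And>t. t \<ge> 0 \<Longrightarrow> \<phi>' t \<le> - \<kappa> * \<phi> t powr \<beta>"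
    and "\<kappa> > 0" and "t > 0"
  shows "\<beta> = 1 \<Longrightarrow> \<phi> t \<le> \<phi> 0 * exp (- \<kappa> * t)"
    and "\<beta> > 1 \<Longrightarrow> \<phi> t \<le> ((\<beta> - 1) * \<kappa>) powr (- 1 / (\<beta> - 1)) / t powr (1 / (\<beta> - 1))"
proof -
  have cont: "continuous_on {0..t} \<phi>"
    by (rule continuous_on_subset[of "{0..}"])
      (auto intro!: DERIV_continuous_on der)
  have DER: "(\<phi> has_real_derivative \<phi>' s) (at s)" if "s > 0" for s
    using der[of s] that at_within_interior[of s "{0..}"] by simp
  {
    assume "\<beta> = 1"
    have "\<phi> t * exp (\<kappa> * t) \<le> \<phi> 0 * exp (\<kappa> * 0)"
    proof (rule nonincreasing_within[of "\<lambda>s. \<phi> s * exp (\<kappa> * s)" "\<lambda>s. (\<phi>' s + \<kappa> * \<phi> s) * exp (\<kappa> * s)" 0 t])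
      fix s :: real assume s: "s \<ge> 0"
      show "((\<lambda>s. \<phi> s * exp (\<kappa> * s)) has_real_derivative (\<phi>' s + \<kappa> * \<phi> s) * exp (\<kappa> * s))
          (at s within {0..})"
        using s by (auto intro!: derivative_eq_intros der simp: algebra_simps)
      show "(\<phi>' s + \<kappa> * \<phi> s) * exp (\<kappa> * s) \<le> 0"
        using le[OF s] nonneg[OF s] \<open>\<beta> = 1\<close> by (simp add: mult_le_0_iff)
    qed (use \<open>t > 0\<close> in auto)
    then show "\<phi> t \<le> \<phi> 0 * exp (- \<kappa> * t)"
      by (simp add: exp_minus field_simps)
  next
    assume "\<beta> > 1"
    show "\<phi> t \<le> ((\<beta> - 1) * \<kappa>) powr (- 1 / (\<beta> - 1)) / t powr (1 / (\<beta> - 1))"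
    \<comment> \<open>The substitution requires \<phi> to be positive on the whole interval up to
      \<open>t\<close>. As \<phi> is nonincreasing, this follows once \<open>\<phi> t\<close> is
      nonzero.\<close>
    proof (cases "\<phi> t = 0")
      case False
      have mono: "\<phi> t \<le> \<phi> s" if "0 \<le> s" "s \<le> t" for s
      proof (rule nonincreasing_within[OF der])
        fix r :: real assume "r \<ge> 0"
        have "0 \<le> \<kappa> * \<phi> r powr \<beta>" using \<open>\<kappa> > 0\<close> by simp
        then show "\<phi>' r \<le> 0" using le[OF \<open>r \<ge> 0\<close>] by simp
      qed (use that in auto)
      have pos: "\<phi> s > 0" if "0 \<le> s" "s \<le> t" for s
        using mono[OF that] nonneg[of t] False \<open>t > 0\<close> by linarith
      let ?\<psi> = "\<lambda>s. \<phi> s powr (1 - \<beta>) - (\<beta> - 1) * \<kappa> * s"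
      have "?\<psi> 0 \<le> ?\<psi> t"
      proof (rule DERIV_nonneg_imp_increasing_open[of 0 t ?\<psi>])
        fix s assume s: "0 < s" "s < t"
        have "(?\<psi> has_real_derivative (1 - \<beta>) * \<phi> s powr (1 - \<beta> - 1) * \<phi>' s - (\<beta> - 1) * \<kappa>) (at s)"
          using s pos[of s]
          by (auto intro!: derivative_eq_intros DERIV_fun_powr[THEN DERIV_cong] DER)
        moreover have "(\<beta> - 1) * \<kappa> \<le> (1 - \<beta>) * \<phi> s powr (1 - \<beta> - 1) * \<phi>' s"
        proof -
          have "\<kappa> = \<phi> s powr - \<beta> * (\<kappa> * \<phi> s powr \<beta>)"
            using pos[of s] s by (simp add: powr_minus)
          also have "\<dots> \<le> \<phi> s powr - \<beta> * (- \<phi>' s)"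
            using le[of s] s by (intro mult_left_mono) auto
          finally have "(\<beta> - 1) * \<kappa> \<le> (\<beta> - 1) * (\<phi> s powr - \<beta> * (- \<phi>' s))"
            using \<open>\<beta> > 1\<close> by (intro mult_left_mono) auto
          then show ?thesis by (simp add: algebra_simps)
        qed
        ultimately show "\<exists>y. (?\<psi> has_real_derivative y) (at s) \<and> 0 \<le> y"
          by force
      next
        show "continuous_on {0..t} ?\<psi>"
          using pos by (intro continuous_intros cont) (auto simp: less_imp_neq[symmetric])
      qed (use \<open>t > 0\<close> in simp)
      \<comment> \<open>The nonnegative term \<open>\<phi> 0 powr (1 - \<beta>)\<close> is dropped,
        which is why the resulting constant does not depend on the initial value.\<close>
      then have *: "(\<beta> - 1) * \<kappa> * t \<le> \<phi> t powr (1 - \<beta>)"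
        using powr_ge_zero[of "\<phi> 0" "1 - \<beta>"] by linarith
      have "\<phi> t = (\<phi> t powr (1 - \<beta>)) powr (- 1 / (\<beta> - 1))"
      proof -
        have "(1 - \<beta>) * (- 1 / (\<beta> - 1)) = 1"
          using \<open>\<beta> > 1\<close> by (simp add: field_simps)
        then show ?thesis
          using pos[of t] \<open>t > 0\<close> by (simp add: powr_powr)
      qed
      also have "\<dots> \<le> ((\<beta> - 1) * \<kappa> * t) powr (- 1 / (\<beta> - 1))"
        using * \<open>\<beta> > 1\<close> \<open>\<kappa> > 0\<close> \<open>t > 0\<close> by (intro powr_mono2') auto
      also have "\<dots> = ((\<beta> - 1) * \<kappa>) powr (- 1 / (\<beta> - 1)) * t powr (- (1 / (\<beta> - 1)))"
        using \<open>\<beta> > 1\<close> \<open>\<kappa> > 0\<close> \<open>t > 0\<close> by (simp add: powr_mult)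
      also have "\<dots> = ((\<beta> - 1) * \<kappa>) powr (- 1 / (\<beta> - 1)) / t powr (1 / (\<beta> - 1))"
        by (simp only: powr_minus divide_inverse)
      finally show ?thesis .
    qed simp
  }
qed

section \<open>One-variable Bregman distances and sums of powers\<close>

text \<open>The tangent at the interior point \<open>s\<close> supports \<open>f\<close> on the
  closed half-line. The point \<open>r\<close> may be 0, where no derivative is assumed; this is the
  case of an active constraint.\<close>

lemma breg_real_nonneg:
  fixes f :: "real \<Rightarrow> real"
  assumes "convex_on {0..} f" and "(f has_real_derivative D) (at s)" and "s > 0" and "r \<ge> 0"
  shows "f r - f s - D * (r - s) \<ge> 0"
proof -
  have "f r - f s \<ge> D * (r - s)"
    using assms
    by (intro convex_on_imp_above_tangent[of "{0..}"])
      (auto intro: has_field_derivative_at_within)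
  then show ?thesis by simp
qed

text \<open>Serves the inactive constraints, whose slack \<open>r\<close> at the solution is
  positive. The symmetrized distance \<open>(f' s - f' r) * (s - r)\<close> dominates, and
  continuity of \<open>f'\<close> bounds its first factor by 1.\<close>

lemma breg_powr_le_dist:
  fixes f f' :: "real \<Rightarrow> real"
  assumes "convex_on {0..} f"
    and der: "\<And>s. s > 0 \<Longrightarrow> (f has_real_derivative f' s) (at s)"
    and cont: "isCont f' r" and "r > 0" and "\<beta> \<ge> 1"
  obtains \<delta> where "\<delta> > 0"
    and "\<And>s. s > 0 \<Longrightarrow> \<bar>s - r\<bar> < \<delta> \<Longrightarrow> (f r - f s - f' s * (r - s)) powr \<beta> \<le> \<bar>s - r\<bar>"
proof -
  obtain \<delta> where \<delta>: "\<delta> > 0" "\<And>s. \<bar>s - r\<bar> < \<delta> \<Longrightarrow> \<bar>f' s - f' r\<bar> < 1"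
    using cont[unfolded continuous_at_eps_delta, rule_format, of 1] by (auto simp: dist_real_def)
  show ?thesis
  \<comment> \<open>The 1 keeps the distance from \<open>s\<close> to \<open>r\<close> below 1, so
    that raising it to a power \<beta> \<ge> 1 does not enlarge it.\<close>
  proof (rule that[of "min \<delta> 1"])
    fix s :: real
    assume s: "s > 0" "\<bar>s - r\<bar> < min \<delta> 1"
    have nn: "f r - f s - f' s * (r - s) \<ge> 0"
      using breg_real_nonneg[OF assms(1) der] s \<open>r > 0\<close> by simp
    have "f s - f r - f' r * (s - r) \<ge> 0"
      using breg_real_nonneg[OF assms(1) der] s \<open>r > 0\<close> by simp
    \<comment> \<open>adding the Bregman distance with the arguments swapped\<close>
    then have "f r - f s - f' s * (r - s) \<le> (f' s - f' r) * (s - r)"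
      by (simp add: algebra_simps)
    also have "\<dots> \<le> \<bar>f' s - f' r\<bar> * \<bar>s - r\<bar>"
      by (metis abs_ge_self abs_mult)
    also have "\<dots> \<le> 1 * \<bar>s - r\<bar>"
      using \<delta>(2)[of s] s by (intro mult_right_mono) auto
    finally have "(f r - f s - f' s * (r - s)) powr \<beta> \<le> \<bar>s - r\<bar> powr \<beta>"
      using nn \<open>\<beta> \<ge> 1\<close> by (intro powr_mono2) auto
    also have "\<dots> \<le> \<bar>s - r\<bar> powr 1"
      using s \<open>\<beta> \<ge> 1\<close> by (intro powr_mono') auto
    finally show "(f r - f s - f' s * (r - s)) powr \<beta> \<le> \<bar>s - r\<bar>"
      by simp
  qed (use \<delta>(1) in simp)
qed

text \<open>The sum is at most the number of terms times the largest term, which is itself one of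
  the \<open>u i\<close> and so obeys the bound.\<close>

lemma sum_powr_le:
  fixes u :: "'p::finite \<Rightarrow> real"
  assumes "\<beta> \<ge> 0" and nonneg: "\<And>i. u i \<ge> 0" and le: "\<And>i. u i powr \<beta> \<le> w"
  shows "(\<Sum>i\<in>UNIV. u i) powr \<beta> \<le> real CARD('p) powr \<beta> * w"
proof -
  define m where "m = Max (range u)"
  have "m \<in> range u"
    unfolding m_def by (rule Max_in) auto
  then obtain j where j: "m = u j" by auto
  have "u i \<le> m" for i
    unfolding m_def by (rule Max_ge) auto
  then have "(\<Sum>i\<in>UNIV. u i) \<le> real CARD('p) * m"
    by (rule sum_bounded_above)
  then have "(\<Sum>i\<in>UNIV. u i) powr \<beta> \<le> (real CARD('p) * m) powr \<beta>"
    using assms by (intro powr_mono2 sum_nonneg) auto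
  also have "\<dots> = real CARD('p) powr \<beta> * m powr \<beta>"
    using nonneg[of j] by (simp add: powr_mult j)
  also have "\<dots> \<le> real CARD('p) powr \<beta> * w"
    using le[of j] by (intro mult_left_mono) (auto simp: j)
  finally show ?thesis .
qed

section \<open>Gradient and Hessian of the barrier\<close>

lemma open_strict_feasible: "open (strict_feasible B d)"
  unfolding strict_feasible_def
  by (simp only: Collect_all_eq, intro open_INT ballI open_Collect_less continuous_on_const
      continuous_on_component matrix_vector_mult_linear_continuous_on) simp

lemma strict_feasible_iff: "y \<in> strict_feasible B d \<longleftrightarrow> (\<forall>i. B $ i \<bullet> y - d $ i > 0)"
  by (simp add: strict_feasible_def matrix_vector_mul_component)

text \<open>Intended for \<open>F = fin h\<close>. The formula for \<open>F\<close> is required only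
  on the strictly feasible set, because \<open>fin\<close> replaces infinite values by 0 elsewhere;
  openness of that set makes this enough for derivatives.\<close>

lemma gradient_barrier:
  fixes B :: "real^'n^'p"
  assumes F: "\<And>z. z \<in> strict_feasible B d \<Longrightarrow> F z = (\<Sum>i\<in>UNIV. f (B $ i \<bullet> z - d $ i))"
    and der: "\<And>s. s > 0 \<Longrightarrow> (f has_real_derivative f' s) (at s)"
    and y: "y \<in> strict_feasible B d"
  shows "gradient F y = (\<Sum>i\<in>UNIV. f' (B $ i \<bullet> y - d $ i) *\<^sub>R B $ i)"
proof (rule gradient_eqI)
  have "((\<lambda>z. f (B $ i \<bullet> z - d $ i)) has_derivative (\<lambda>v. f' (B $ i \<bullet> y - d $ i) * (B $ i \<bullet> v))) (at y)" for i
  proof -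
    have 1: "((\<lambda>z. B $ i \<bullet> z - d $ i) has_derivative (\<lambda>v. B $ i \<bullet> v)) (at y)"
      by (auto intro!: derivative_eq_intros)
    have 2: "(f has_derivative (*) (f' (B $ i \<bullet> y - d $ i))) (at (B $ i \<bullet> y - d $ i))"
      using der y by (simp add: has_field_derivative_def strict_feasible_iff)
    show ?thesis
      using has_derivative_compose[OF 1 2] .
  qed
  then have "((\<lambda>z. \<Sum>i\<in>UNIV. f (B $ i \<bullet> z - d $ i)) has_derivative
      (\<lambda>v. \<Sum>i\<in>UNIV. f' (B $ i \<bullet> y - d $ i) * (B $ i \<bullet> v))) (at y)"
    by (rule has_derivative_sum)
  then have "(F has_derivative (\<lambda>v. \<Sum>i\<in>UNIV. f' (B $ i \<bullet> y - d $ i) * (B $ i \<bullet> v))) (at y)"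
    by (rule has_derivative_transform_within_open[OF _ open_strict_feasible y]) (simp add: F)
  then show "(F has_derivative (\<lambda>v. (\<Sum>i\<in>UNIV. f' (B $ i \<bullet> y - d $ i) *\<^sub>R B $ i) \<bullet> v)) (at y)"
    by (simp add: inner_sum_left)
qed

text \<open>The Hessian is a weighted sum of the rank-one matrices built from the rows of
  \<open>B\<close>. Giving its action on vectors avoids matrix entries.\<close>

lemma hessian_barrier:
  fixes B :: "real^'n^'p"
  assumes F: "\<And>z. z \<in> strict_feasible B d \<Longrightarrow> F z = (\<Sum>i\<in>UNIV. f (B $ i \<bullet> z - d $ i))"
    and der: "\<And>s. s > 0 \<Longrightarrow> (f has_real_derivative f' s) (at s)"
    and der2: "\<And>s. s > 0 \<Longrightarrow> (f' has_real_derivative f'' s) (at s)"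
    and y: "y \<in> strict_feasible B d"
  shows "hessian F y *v v = (\<Sum>i\<in>UNIV. (f'' (B $ i \<bullet> y - d $ i) * (B $ i \<bullet> v)) *\<^sub>R B $ i)"
proof -
  let ?H = "\<lambda>v. \<Sum>i\<in>UNIV. (f'' (B $ i \<bullet> y - d $ i) * (B $ i \<bullet> v)) *\<^sub>R B $ i"
  have "((\<lambda>z. f' (B $ i \<bullet> z - d $ i)) has_derivative (\<lambda>v. f'' (B $ i \<bullet> y - d $ i) * (B $ i \<bullet> v))) (at y)" for i
  proof -
    have 1: "((\<lambda>z. B $ i \<bullet> z - d $ i) has_derivative (\<lambda>v. B $ i \<bullet> v)) (at y)"
      by (auto intro!: derivative_eq_intros)
    have 2: "(f' has_derivative (*) (f'' (B $ i \<bullet> y - d $ i))) (at (B $ i \<bullet> y - d $ i))"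
      using der2 y by (simp add: has_field_derivative_def strict_feasible_iff)
    show ?thesis
      using has_derivative_compose[OF 1 2] .
  qed
  then have "((\<lambda>z. \<Sum>i\<in>UNIV. f' (B $ i \<bullet> z - d $ i) *\<^sub>R B $ i) has_derivative ?H) (at y)"
    by (intro has_derivative_sum has_derivative_scaleR_left)
  then have H: "(gradient F has_derivative ?H) (at y)"
    by (rule has_derivative_transform_within_open[OF _ open_strict_feasible y])
      (simp add: gradient_barrier[OF F der])
  then have "hessian F y = matrix ?H"
    unfolding hessian_def using frechet_derivative_at[OF H] by simp
  moreover have "matrix ?H *v v = ?H v"
    using fun_cong[OF matrix_vector_mul(2)[OF has_derivative_linear[OF H]], of v] .
  ultimately show ?thesis
    by simp
qed

text \<open>Pairing \<open>hessian F y *v v\<close> with \<open>v\<close> gives a sum of the squares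
  of the \<open>B $ i \<bullet> v\<close> with positive weights. If it vanishes then
  \<open>B *v v = 0\<close>, so the kernel is trivial by injectivity of \<open>B\<close>; a square
  matrix with trivial kernel is invertible.\<close>

lemma invertible_hessian_barrier:
  fixes B :: "real^'n^'p"
  assumes inj: "inj ((*v) B)"
    and F: "\<And>z. z \<in> strict_feasible B d \<Longrightarrow> F z = (\<Sum>i\<in>UNIV. f (B $ i \<bullet> z - d $ i))"
    and der: "\<And>s. s > 0 \<Longrightarrow> (f has_real_derivative f' s) (at s)"
    and der2: "\<And>s. s > 0 \<Longrightarrow> (f' has_real_derivative f'' s) (at s)"
    and pos: "\<And>s. s > 0 \<Longrightarrow> f'' s > 0"
    and y: "y \<in> strict_feasible B d"
  shows "invertible (hessian F y)"
proof -
  have "v = 0" if "hessian F y *v v = 0" for v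
  proof -
    have nn: "f'' (B $ i \<bullet> y - d $ i) > 0" for i
      using pos y by (simp add: strict_feasible_iff)
    have "0 = (\<Sum>i\<in>UNIV. f'' (B $ i \<bullet> y - d $ i) * (B $ i \<bullet> v)\<^sup>2)"
      using arg_cong[OF hessian_barrier[OF F der der2 y, of v], of "\<lambda>w. w \<bullet> v"] that
      by (simp add: inner_sum_left power2_eq_square mult.assoc)
    then have "f'' (B $ i \<bullet> y - d $ i) * (B $ i \<bullet> v)\<^sup>2 = 0" for i
      using nn by (subst (asm) eq_commute, subst (asm) sum_nonneg_eq_0_iff)
        (auto simp: less_imp_le)
    then have "B $ i \<bullet> v = 0" for i
      using nn[of i] by (metis less_irrefl mult_eq_0_iff power_eq_0_iff)
    then have "B *v v = B *v 0"
      by (simp add: vec_eq_iff matrix_vector_mul_component)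
    then show "v = 0"
      using inj by (rule inj_eq[THEN iffD1, rotated])
  qed
  then have "inj ((*v) (hessian F y))"
    by (simp add: linear_injective_0)
  then show ?thesis
    by (simp add: invertible_left_inverse matrix_left_invertible_injective)
qed

section \<open>Real-valued convexity on the effective domain\<close>

lemma convex_on_fin:
  assumes "g \<in> Gamma0"
  shows "convex_on (eff_dom g) (fin g)"
proof -
  have fin: "g z = ereal (fin g z)" if "z \<in> eff_dom g" for z
    using assms that by (auto simp: Gamma0_def proper_fun_def eff_dom_def fin_def ereal_real)
  have le: "g ((1 - t) *\<^sub>R y + t *\<^sub>R z) \<le> ereal ((1 - t) * fin g y + t * fin g z)"
    if "0 < t" "t < 1" "y \<in> eff_dom g" "z \<in> eff_dom g" for t y z
    using assms that fin unfolding Gamma0_def convex_ereal_def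
    by (metis (mono_tags, lifting) mem_Collect_eq plus_ereal.simps(1) times_ereal.simps(1))
  have in_dom: "(1 - t) *\<^sub>R y + t *\<^sub>R z \<in> eff_dom g"
    if "0 < t" "t < 1" "y \<in> eff_dom g" "z \<in> eff_dom g" for t y z
    using le[OF that] by (auto simp: eff_dom_def intro: le_less_trans)
  show ?thesis
  proof (rule convex_onI)
    fix t :: real and y z
    assume "0 < t" "t < 1" "y \<in> eff_dom g" "z \<in> eff_dom g"
    from le[OF this] fin[OF in_dom[OF this]]
    show "fin g ((1 - t) *\<^sub>R y + t *\<^sub>R z) \<le> (1 - t) * fin g y + t * fin g z"
      by simp
  next
    show "convex (eff_dom g)"
      unfolding convex_alt
    proof (intro ballI allI impI)
      fix y z and t :: real
      assume *: "y \<in> eff_dom g" "z \<in> eff_dom g" "0 \<le> t \<and> t \<le> 1"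
      \<comment> \<open>\<open>convex_ereal\<close> speaks only of weights strictly between 0 and 1,
        so the endpoints are separate cases.\<close>
      then consider "t = 0" | "t = 1" | "0 < t" "t < 1" by linarith
      then show "(1 - t) *\<^sub>R y + t *\<^sub>R z \<in> eff_dom g"
        using * in_dom by cases auto
    qed
  qed
qed

section \<open>The error bound on a sublevel set\<close>

text \<open>By sharpness it suffices to bound the power of the sum by a multiple of
  \<open>norm (y - a)\<close>. Near \<open>a\<close> the termwise bounds do this; far from
  \<open>a\<close> the norm is bounded below while the sum is at most \<gamma>.\<close>

lemma error_bound:
  fixes c a :: "real^'n" and B :: "real^'n^'p" and D :: "'p \<Rightarrow> real \<Rightarrow> real"
  assumes sol: "lp_solutions c B d = {a}"
    and "\<beta> \<ge> 1" "\<delta> > 0" "K > 0" "\<gamma> \<ge> 0"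
    and nonneg: "\<And>i s. s > 0 \<Longrightarrow> D i s \<ge> 0"
    and bound: "\<And>i s. s > 0 \<Longrightarrow> \<bar>s - (B $ i \<bullet> a - d $ i)\<bar> < \<delta>
        \<Longrightarrow> D i s powr \<beta> \<le> K * \<bar>s - (B $ i \<bullet> a - d $ i)\<bar>"
  obtains \<kappa> where "\<kappa> > 0"
    and "\<And>y. y \<in> strict_feasible B d \<Longrightarrow> (\<Sum>i\<in>UNIV. D i (B $ i \<bullet> y - d $ i)) \<le> \<gamma>
        \<Longrightarrow> \<kappa> * (\<Sum>i\<in>UNIV. D i (B $ i \<bullet> y - d $ i)) powr \<beta> \<le> c \<bullet> y - c \<bullet> a"
proof -
  obtain \<mu> where \<mu>: "\<mu> > 0"
    "\<And>y. \<forall>i. (B *v y) $ i \<ge> d $ i \<Longrightarrow> c \<bullet> y - c \<bullet> a \<ge> \<mu> * norm (y - a)"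
    using sharp_minimum[OF sol] by blast
  \<comment> \<open>A common Lipschitz constant of all the slacks
    \<open>B $ i \<bullet> y - d $ i\<close>; the added 1 makes it positive even if all rows
    vanish.\<close>
  define N where "N = 1 + (\<Sum>i\<in>UNIV. norm (B $ i))"
  have "N > 0"
    unfolding N_def by (intro add_pos_nonneg sum_nonneg) auto
  \<comment> \<open>The first summand is the constant for points near \<open>a\<close>, the second
    the one for points far from it.\<close>
  define A where "A = real CARD('p) powr \<beta> * (K * N) + \<gamma> powr \<beta> * (N / \<delta>)"
  have "A > 0"
    unfolding A_def using \<open>K > 0\<close> \<open>N > 0\<close> \<open>\<delta> > 0\<close>
    by (intro add_pos_nonneg mult_pos_pos mult_nonneg_nonneg) auto
  show ?thesis
  proof (rule that[of "\<mu> / A"])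
    show "\<mu> / A > 0" using \<mu>(1) \<open>A > 0\<close> by simp
  next
    fix y
    assume y: "y \<in> strict_feasible B d" and le: "(\<Sum>i\<in>UNIV. D i (B $ i \<bullet> y - d $ i)) \<le> \<gamma>"
    let ?S = "\<Sum>i\<in>UNIV. D i (B $ i \<bullet> y - d $ i)"
    have pos: "B $ i \<bullet> y - d $ i > 0" for i
      using y by (simp add: strict_feasible_iff)
    have dist: "\<bar>(B $ i \<bullet> y - d $ i) - (B $ i \<bullet> a - d $ i)\<bar> \<le> N * norm (y - a)" for i
    proof -
      have "norm (B $ i) \<le> (\<Sum>i\<in>UNIV. norm (B $ i))"
        by (rule member_le_sum) auto
      then have "norm (B $ i) \<le> N" by (simp add: N_def)
      have "\<bar>(B $ i \<bullet> y - d $ i) - (B $ i \<bullet> a - d $ i)\<bar> = \<bar>B $ i \<bullet> (y - a)\<bar>"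
        by (simp add: inner_diff_right)
      also have "\<dots> \<le> norm (B $ i) * norm (y - a)"
        by (rule Cauchy_Schwarz_ineq2)
      also have "\<dots> \<le> N * norm (y - a)"
        using \<open>norm (B $ i) \<le> N\<close> by (intro mult_right_mono) auto
      finally show ?thesis .
    qed
    have "?S powr \<beta> \<le> A * norm (y - a)"
    proof (cases "N * norm (y - a) < \<delta>")
      case True
      have "D i (B $ i \<bullet> y - d $ i) powr \<beta> \<le> K * (N * norm (y - a))" for i
        using bound[OF pos[of i] le_less_trans[OF dist True]] dist[of i] \<open>K > 0\<close>
        by (meson less_imp_le mult_left_mono order_trans)
      then have "?S powr \<beta> \<le> real CARD('p) powr \<beta> * (K * (N * norm (y - a)))"
        using nonneg pos \<open>\<beta> \<ge> 1\<close> by (intro sum_powr_le) auto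
      also have "\<dots> \<le> A * norm (y - a)"
        using \<open>N > 0\<close> \<open>\<delta> > 0\<close> unfolding A_def distrib_right by (simp add: mult.assoc)
      finally show ?thesis .
    next
      case False
      have "?S powr \<beta> \<le> \<gamma> powr \<beta>"
        using le nonneg pos \<open>\<beta> \<ge> 1\<close> by (intro powr_mono2 sum_nonneg) auto
      \<comment> \<open>Far from \<open>a\<close> the factor
        \<open>N / \<delta> * norm (y - a)\<close> is at least 1.\<close>
      also have "\<gamma> powr \<beta> \<le> \<gamma> powr \<beta> * (N / \<delta> * norm (y - a))"
        using False \<open>\<delta> > 0\<close> mult_left_mono[of 1 "N / \<delta> * norm (y - a)" "\<gamma> powr \<beta>"]
        by (simp add: field_simps)
      also have "\<dots> \<le> A * norm (y - a)"
        using \<open>N > 0\<close> \<open>K > 0\<close> unfolding A_def distrib_right by (simp add: mult.assoc)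
      finally show ?thesis by simp
    qed
    then have "\<mu> * ?S powr \<beta> \<le> A * (\<mu> * norm (y - a))"
      using \<mu>(1) by (simp add: mult.left_commute)
    also have "\<dots> \<le> A * (c \<bullet> y - c \<bullet> a)"
      using \<mu>(2)[of y] y \<open>A > 0\<close>
      by (intro mult_left_mono) (auto simp: strict_feasible_def less_imp_le)
    finally show "\<mu> / A * ?S powr \<beta> \<le> c \<bullet> y - c \<bullet> a"
      using \<open>A > 0\<close> by (simp add: field_simps)
  qed
qed

section \<open>Decay of the Bregman distance along the trajectory\<close>

lemma Ck_on_has_deriv:
  assumes "Ck_on k S f" "open S" "s \<in> S" "j < k"
  shows "((deriv ^^ j) f has_real_derivative deriv ((deriv ^^ j) f) s) (at s)"
proof -
  have "(deriv ^^ j) f differentiable at s"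
    using assms unfolding Ck_on_def differentiable_on_def by (metis at_within_open)
  then show ?thesis
    by (simp add: DERIV_deriv_iff_real_differentiable)
qed

theorem lemma4p5:
  fixes c x0 a :: "real^'n" and B :: "real^'n^'p" and d :: "real^'p"
    and \<theta> :: "real \<Rightarrow> ereal" and h :: "real^'n \<Rightarrow> ereal"
    and \<alpha> \<beta> \<epsilon> :: real and x :: "real \<Rightarrow> real^'n"
  assumes "CARD('p) \<ge> CARD('n)" and "rank B = min CARD('p) CARD('n)"
    and "lp_solutions c B d = {a}"
    and "x0 \<in> strict_feasible B d"
    and "h = (\<lambda>y. \<Sum>i\<in>UNIV. \<theta> (B $ i \<bullet> y - d $ i))"
    and "\<theta> \<in> Gamma0" and "legendre_type \<theta>"
    and "{0<..} \<subseteq> eff_dom \<theta>" and "eff_dom \<theta> \<subseteq> {0..}"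
    and "Ck_on 3 {0<..} (fin \<theta>)"
    and "filterlim (deriv (fin \<theta>)) at_bot (at_right 0)"
    and "\<forall>s>0. deriv (deriv (fin \<theta>)) s > 0"
    and "bregman_function {0<..} \<theta>"
    and "\<alpha> > 0" and "\<beta> \<ge> 1" and "\<epsilon> > 0"
    and "\<forall>s\<in>{0<..<\<epsilon>}. \<alpha> * breg \<theta> 0 s powr \<beta> \<le> s"
    and "HSD_solution h (strict_feasible B d) c x0 x"
  shows "\<exists>K>0. \<exists>L>0. \<exists>M>0. \<forall>t>0.
           (\<beta> = 1 \<longrightarrow> breg h a (x t) \<le> K * exp (- L * t)) \<and>
           (\<beta> > 1 \<longrightarrow> breg h a (x t) \<le> M / t powr (1 / (\<beta> - 1)))"
proof -
  define f where "f = fin \<theta>"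
  define f' where "f' = deriv f"
  define f'' where "f'' = deriv f'"
  \<comment> \<open>\<open>r i\<close> is the slack of constraint \<open>i\<close> at the solution,
    zero exactly when the constraint is active. \<open>D i u\<close> is the Bregman distance of
    \<theta> from \<open>r i\<close> to \<open>u\<close>.\<close>
  define r where "r i = B $ i \<bullet> a - d $ i" for i
  define s where "s i y = B $ i \<bullet> y - d $ i" for i y
  define D where "D i u = f (r i) - f u - f' u * (r i - u)" for i u
  define \<phi> where "\<phi> t = (\<Sum>i\<in>UNIV. D i (s i (x t)))" for t
  have der: "(f has_real_derivative f' u) (at u)" if "u > 0" for u
    using Ck_on_has_deriv[OF assms(10), of u 0] that by (simp add: f_def f'_def)
  have der2: "(f' has_real_derivative f'' u) (at u)" if "u > 0" for u
    using Ck_on_has_deriv[OF assms(10), of u 1] that by (simp add: f_def f'_def f''_def)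
  have f''_pos: "f'' u > 0" if "u > 0" for u
    using assms(12) that by (simp add: f_def f'_def f''_def)
  \<comment> \<open>The Bregman property puts 0 into the domain, so \<theta> is finite at the
    vanishing slacks of active constraints.\<close>
  have dom: "eff_dom \<theta> = {0..}"
    using assms(13) by (simp add: bregman_function_def)
  have conv: "convex_on {0..} f"
    using convex_on_fin[OF assms(6)] by (simp add: dom f_def)
  have \<theta>: "\<theta> u = ereal (f u)" if "u \<ge> 0" for u
  proof -
    have "\<theta> u < \<infinity>" using dom that by (auto simp: eff_dom_def)
    moreover have "\<theta> u \<noteq> -\<infinity>" using assms(6) by (simp add: Gamma0_def proper_fun_def)
    ultimately show ?thesis by (cases "\<theta> u") (auto simp: f_def fin_def)
  qed
  \<comment> \<open>Stated for nonnegative slacks because it is applied at \<open>a\<close>, which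
    may lie on the boundary.\<close>
  have fin_h: "fin h y = (\<Sum>i\<in>UNIV. f (B $ i \<bullet> y - d $ i))" if "\<And>i. B $ i \<bullet> y - d $ i \<ge> 0" for y
    using that by (simp add: assms(5) fin_def \<theta>)
  have F: "fin h y = (\<Sum>i\<in>UNIV. f (B $ i \<bullet> y - d $ i))" if "y \<in> strict_feasible B d" for y
    using that by (intro fin_h) (simp add: strict_feasible_iff less_imp_le)
  have r_nonneg: "r i \<ge> 0" for i
  proof -
    have "a \<in> lp_solutions c B d" using assms(3) by simp
    then show ?thesis
      by (simp add: lp_solutions_def is_arg_min_def r_def matrix_vector_mul_component)
  qed
  have xC: "x t \<in> strict_feasible B d" if "t \<ge> 0" for t
    using assms(18) that by (simp add: HSD_solution_def)
  have s_pos: "s i y > 0" if "y \<in> strict_feasible B d" for i y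
    using that by (simp add: strict_feasible_iff s_def)
  have D_nonneg: "D i u \<ge> 0" if "u > 0" for i u
    unfolding D_def using breg_real_nonneg[OF conv der[OF that] that r_nonneg] .
  have breg_h: "breg h a y = (\<Sum>i\<in>UNIV. D i (s i y))" if "y \<in> strict_feasible B d" for y
  proof -
    have "fin h a = (\<Sum>i\<in>UNIV. f (r i))"
      unfolding r_def using r_nonneg by (intro fin_h) (simp add: r_def)
    moreover have "gradient (fin h) y \<bullet> (a - y) = (\<Sum>i\<in>UNIV. f' (s i y) * (r i - s i y))"
      by (simp add: gradient_barrier[OF F der that] inner_sum_left r_def s_def flip: inner_diff_right)
    ultimately show ?thesis
      by (simp add: breg_def F[OF that] D_def sum_subtractf s_def)
  qed
  have inj: "inj ((*v) B)"
    using assms(1,2) by (simp add: full_rank_injective[symmetric] min_def)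
  \<comment> \<open>The \<open>f'\<close> terms cancel on differentiation, so each summand
    contributes minus \<open>f''\<close> times the slack velocity times
    \<open>r i - s i (x t)\<close>. Summed up, this is the pairing of minus the Hessian applied to
    the velocity, that is of \<open>c\<close>, with \<open>a - x t\<close>.\<close>
  have der_\<phi>: "(\<phi> has_real_derivative - (c \<bullet> x t - c \<bullet> a)) (at t within {0..})" if "t \<ge> 0" for t
  proof -
    let ?H = "hessian (fin h) (x t)"
    define v where "v = - (matrix_inv ?H *v c)"
    have x': "(x has_vector_derivative v) (at t within {0..})"
      using assms(18) that by (simp add: HSD_solution_def v_def)
    have s': "((\<lambda>t. s i (x t)) has_real_derivative B $ i \<bullet> v) (at t within {0..})" for i
    proof -
      have "((\<lambda>t. B $ i \<bullet> x t) has_real_derivative B $ i \<bullet> v) (at t within {0..})"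
        using bounded_linear.has_vector_derivative[OF bounded_linear_inner_right x']
        by (simp only: has_real_derivative_iff_has_vector_derivative)
      from DERIV_diff[OF this DERIV_const[of "d $ i"]] show ?thesis
        by (simp add: s_def)
    qed
    have "invertible ?H"
      using invertible_hessian_barrier[OF inj F der der2 f''_pos xC[OF that]] .
    \<comment> \<open>\<open>matrix_inv\<close> is defined by choice; invertibility makes the chosen
      matrix a genuine inverse.\<close>
    then have "?H ** matrix_inv ?H = mat 1"
      unfolding invertible_def matrix_inv_def by (rule someI2_ex) simp
    then have "?H *v v = - c"
      by (simp add: v_def linear_neg[OF matrix_vector_mul_linear] matrix_vector_mul_assoc)
    then have "(\<Sum>i\<in>UNIV. (f'' (s i (x t)) * (B $ i \<bullet> v)) *\<^sub>R B $ i) \<bullet> (a - x t) = - c \<bullet> (a - x t)"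
      using hessian_barrier[OF F der der2 xC[OF that], of v] by (simp add: s_def)
    then have sum: "(\<Sum>i\<in>UNIV. - (f'' (s i (x t)) * (B $ i \<bullet> v)) * (r i - s i (x t))) = - (c \<bullet> x t - c \<bullet> a)"
      unfolding r_def s_def
      by (simp add: inner_sum_left sum_negf flip: inner_diff_right) (simp add: inner_diff_right)
    have "((\<lambda>t. D i (s i (x t))) has_real_derivative
        - (f'' (s i (x t)) * (B $ i \<bullet> v)) * (r i - s i (x t))) (at t within {0..})" for i
    proof -
      have pos: "s i (x t) > 0" using s_pos xC that by blast
      note chain = DERIV_chain2[where g = "\<lambda>t. s i (x t)", OF _ s']
      show ?thesis
        unfolding D_def
        by (rule derivative_eq_intros chain[OF der[OF pos]] chain[OF der2[OF pos]] s' refl)+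
          (simp add: algebra_simps)
    qed
    then show ?thesis
      unfolding \<phi>_def sum[symmetric] by (rule DERIV_sum)
  qed
  have opt: "c \<bullet> a \<le> c \<bullet> x t" if "t \<ge> 0" for t
  proof -
    have "a \<in> lp_solutions c B d" using assms(3) by simp
    then show ?thesis
      using xC[OF that]
      by (simp add: lp_solutions_def is_arg_min_linorder strict_feasible_def less_imp_le)
  qed
  have \<phi>_nonneg: "\<phi> t \<ge> 0" if "t \<ge> 0" for t
    unfolding \<phi>_def using D_nonneg s_pos xC[OF that] by (intro sum_nonneg) auto
  have "\<exists>\<delta>>0. \<exists>K>0. \<forall>u>0. \<bar>u - r i\<bar> < \<delta> \<longrightarrow> D i u powr \<beta> \<le> K * \<bar>u - r i\<bar>" for i
  proof (cases "r i = 0")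
    case True
    \<comment> \<open>For an active constraint the distance from \<open>u\<close> to
      \<open>r i\<close> is \<open>u\<close> itself, and dividing the growth hypothesis by \<alpha>
      gives the constant.\<close>
    have "D i u powr \<beta> \<le> 1 / \<alpha> * \<bar>u - r i\<bar>" if "u > 0" "\<bar>u - r i\<bar> < \<epsilon>" for u
    proof -
      have "breg \<theta> 0 u = D i u"
        using gradient_real[OF der[OF that(1)]] True by (simp add: breg_def D_def f_def)
      then show ?thesis
        using assms(14,17) that True by (force simp: field_simps)
    qed
    then show ?thesis
      using assms(14,16) by (intro exI[of _ \<epsilon>] exI[of _ "1 / \<alpha>"] conjI) auto
  next
    case False
    then have "r i > 0" using r_nonneg[of i] by simp
    show ?thesis
      using breg_powr_le_dist[OF conv der DERIV_isCont[OF der2[OF \<open>r i > 0\<close>]] \<open>r i > 0\<close> assms(15)]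
      unfolding D_def by (metis mult_1 zero_less_one)
  qed
  then obtain \<delta> K where \<delta>K: "\<And>i. \<delta> i > 0" "\<And>i. K i > 0"
    "\<And>i u. u > 0 \<Longrightarrow> \<bar>u - r i\<bar> < \<delta> i \<Longrightarrow> D i u powr \<beta> \<le> K i * \<bar>u - r i\<bar>"
    by metis
  \<comment> \<open>Finitely many constraints allow uniform constants, the least \<delta> and the
    largest \<open>K\<close>. The level is \<open>\<phi> 0\<close>, which the trajectory is shown
    below not to exceed.\<close>
  obtain \<kappa> where \<kappa>: "\<kappa> > 0"
    "\<And>y. y \<in> strict_feasible B d \<Longrightarrow> (\<Sum>i\<in>UNIV. D i (s i y)) \<le> \<phi> 0
      \<Longrightarrow> \<kappa> * (\<Sum>i\<in>UNIV. D i (s i y)) powr \<beta> \<le> c \<bullet> y - c \<bullet> a"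
  proof (rule error_bound[OF assms(3,15), of "Min (range \<delta>)" "Max (range K)" "\<phi> 0" D])
    show "Min (range \<delta>) > 0" using \<delta>K(1) by simp
    show "Max (range K) > 0" using \<delta>K(2) by (simp add: Max_gr_iff)
    show "\<phi> 0 \<ge> 0" by (simp add: \<phi>_nonneg)
    fix i and u :: real
    assume u: "u > 0"
    then show "D i u \<ge> 0" by (rule D_nonneg)
    assume "\<bar>u - (B $ i \<bullet> a - d $ i)\<bar> < Min (range \<delta>)"
    then have "D i u powr \<beta> \<le> K i * \<bar>u - r i\<bar>"
      using u by (intro \<delta>K(3)) (auto simp: r_def)
    also have "\<dots> \<le> Max (range K) * \<bar>u - r i\<bar>"
      by (intro mult_right_mono) auto
    finally show "D i u powr \<beta> \<le> Max (range K) * \<bar>u - (B $ i \<bullet> a - d $ i)\<bar>"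
      by (simp add: r_def)
  qed (use that in \<open>auto simp: s_def\<close>)
  \<comment> \<open>Optimality of \<open>a\<close> alone makes the derivative of \<phi> nonpositive,
    so the error bound applies at all times.\<close>
  have \<phi>_le: "\<phi> t \<le> \<phi> 0" if "t \<ge> 0" for t
    by (rule nonincreasing_within[OF der_\<phi>]) (use opt that in auto)
  have decay: "- (c \<bullet> x t - c \<bullet> a) \<le> - \<kappa> * \<phi> t powr \<beta>" if "t \<ge> 0" for t
    using \<kappa>(2)[OF xC[OF that]] \<phi>_le[OF that] by (simp add: \<phi>_def)
  show ?thesis
  proof (intro exI conjI allI impI)
    \<comment> \<open>Both outer constants must be positive for every \<beta>. Only
      \<open>\<phi> 0 \<ge> 0\<close> has been established, and for \<beta> = 1 the power has base 0
      and hence value 0; adding 1 settles both.\<close>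
    show "\<phi> 0 + 1 > 0" using \<phi>_nonneg[of 0] by simp
    show "\<kappa> > 0" by fact
    show "((\<beta> - 1) * \<kappa>) powr (- 1 / (\<beta> - 1)) + 1 > 0"
      by (simp add: add_nonneg_pos)
    fix t :: real
    assume "t > 0"
    have breg: "breg h a (x t) = \<phi> t"
      using breg_h[OF xC] \<open>t > 0\<close> by (simp add: \<phi>_def)
    show "breg h a (x t) \<le> (\<phi> 0 + 1) * exp (- \<kappa> * t)" if "\<beta> = 1"
    proof -
      have "\<phi> t \<le> \<phi> 0 * exp (- \<kappa> * t)"
        by (rule powr_decay(1)[OF der_\<phi> \<phi>_nonneg decay \<kappa>(1) \<open>t > 0\<close> that])
      also have "\<dots> \<le> (\<phi> 0 + 1) * exp (- \<kappa> * t)"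
        by (intro mult_right_mono) auto
      finally show ?thesis by (simp add: breg)
    qed
    show "breg h a (x t) \<le> (((\<beta> - 1) * \<kappa>) powr (- 1 / (\<beta> - 1)) + 1) / t powr (1 / (\<beta> - 1))"
      if "\<beta> > 1"
    proof -
      have "\<phi> t \<le> ((\<beta> - 1) * \<kappa>) powr (- 1 / (\<beta> - 1)) / t powr (1 / (\<beta> - 1))"
        by (rule powr_decay(2)[OF der_\<phi> \<phi>_nonneg decay \<kappa>(1) \<open>t > 0\<close> that])
      also have "\<dots> \<le> (((\<beta> - 1) * \<kappa>) powr (- 1 / (\<beta> - 1)) + 1) / t powr (1 / (\<beta> - 1))"
        by (intro divide_right_mono) auto
      finally show ?thesis by (simp add: breg)
    qed
  qed
qed

end
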